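(* For $q\in\mathbb{C}$ with $|q|<1$, $$\sum_{i,j\ge0}\frac{q^{4ij+i+3j}}{(q;q)_{2i+1}(q;q)_{2j}}=\frac{(q^8;q^8)_\infty}{(q;q^2)_\infty^2\,(q^4;q^8)_\infty}.$$
   Context: For $|q|<1$: $(a;q)_\infty=\prod_{k\ge0}(1-aq^k)$ and, for integers $n\ge0$, $(a;q)_n=\prod_{k=0}^{n-1}(1-aq^k)$. *)

theory Defs
  imports "HOL-Analysis.Analysis"
begin

definition qpochhammer :: "complex \<Rightarrow> complex \<Rightarrow> nat \<Rightarrow> complex" where
  "qpochhammer a q n = (\<Prod>k<n. 1 - a * q ^ k)"

(* Meaningful for norm q < 1, where the product converges. prodinf is the library's limit
   of the partial products, also when some factor vanishes. *)
definition qpochhammer_inf :: "complex \<Rightarrow> complex \<Rightarrow> complex" where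
  "qpochhammer_inf a q = (\<Prod>k. 1 - a * q ^ k)"

end

theory Submission
  imports Defs
begin

text \<open>
  Put $x = \sqrt q$. For fixed $j$, the sum over $i$ is the odd part of Euler's series
  $\sum_n z^n / (q;q)_n = 1 / (z;q)_\infty$ at $z = x q^{2j}$. It equals
  $\frac{q^j}{2x\,(q;q)_{2j}} \bigl( \frac{(x;q)_{2j}}{(x;q)_\infty} -
  \frac{(-x;q)_{2j}}{(-x;q)_\infty} \bigr)$. The sum over $j$ of each of these two terms is the
  even part of a $q$-binomial series, with parameter and argument $\pm x$. The mixed terms cancel,
  leaving $\frac{(q;q)_\infty}{4x} \bigl( (x;q)_\infty^{-2} - (-x;q)_\infty^{-2} \bigr)$.
  By the Jacobi triple product, $(q;q)_\infty \bigl( (-x;q)_\infty^2 - (x;q)_\infty^2 \bigr)$ is twice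
  the odd part of $\sum_{n \in \mathbb{Z}} x^{n^2}$, and that part is $2x$ times the series of Gauss
  over triangular numbers in $q^4$.
\<close>

section \<open>Finite and infinite q-Pochhammer symbols: nonvanishing, limits and
  factorisations\<close>

lemma one_minus_mult_power_nonzero:
  fixes a q :: complex
  assumes "norm a < 1" "norm q < 1"
  shows "1 - a * q ^ k \<noteq> 0"
proof -
  have "norm (a * q ^ k) < 1"
    using assms by (auto simp: norm_mult norm_power
        intro: order.strict_trans1[OF mult_left_le[OF power_le_one]])
  then show ?thesis
    by auto
qed

lemma qpochhammer_nonzero:
  assumes "norm a < 1" "norm q < 1"
  shows "qpochhammer a q n \<noteq> 0"
  using one_minus_mult_power_nonzero[OF assms] by (simp add: qpochhammer_def)

lemma qpochhammer_Suc: "qpochhammer a q (Suc n) = qpochhammer a q n * (1 - a * q ^ n)"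
  by (simp add: qpochhammer_def)

lemma qpochhammer_0 [simp]: "qpochhammer a q 0 = 1"
  by (simp add: qpochhammer_def)

lemma convergent_qpochhammer_inf:
  fixes a q :: complex
  assumes "norm q < 1"
  shows "convergent_prod (\<lambda>k. 1 - a * q ^ k)"
proof -
  have "summable (\<lambda>k. norm (- a * q ^ k))"
    using summable_mult[OF summable_geometric[of "norm q"], of "norm a"] assms
    by (simp add: norm_mult norm_power)
  then have "convergent_prod (\<lambda>k. 1 + - a * q ^ k)"
    by (intro abs_convergent_prod_imp_convergent_prod)
      (simp add: abs_convergent_prod_conv_summable)
  then show ?thesis
    by simp
qed

lemma qpochhammer_LIMSEQ:
  assumes "norm q < 1"
  shows "qpochhammer a q \<longlonglongrightarrow> qpochhammer_inf a q"
proof (rule LIMSEQ_imp_Suc)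
  \<comment> \<open>\<open>convergent_prod_LIMSEQ\<close> concerns products over
    \<open>{..n}\<close>, which have one factor more than \<open>qpochhammer a q n\<close>.\<close>
  show "(\<lambda>n. qpochhammer a q (Suc n)) \<longlonglongrightarrow> qpochhammer_inf a q"
    using convergent_prod_LIMSEQ[OF convergent_qpochhammer_inf[OF assms, of a]]
    by (simp add: qpochhammer_def qpochhammer_inf_def lessThan_Suc_atMost)
qed

lemma qpochhammer_inf_nonzero:
  assumes "norm a < 1" "norm q < 1"
  shows "qpochhammer_inf a q \<noteq> 0"
  unfolding qpochhammer_inf_def
  using one_minus_mult_power_nonzero[OF assms] convergent_qpochhammer_inf[OF assms(2)]
  by (intro prodinf_nonzero) auto

lemma qpochhammer_add:
  "qpochhammer a q (m + n) = qpochhammer a q m * qpochhammer (a * q ^ m) q n"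
  by (induction n) (simp_all add: qpochhammer_Suc power_add mult.assoc)

lemma qpochhammer_inf_split:
  assumes "norm q < 1"
  shows "qpochhammer_inf a q = qpochhammer a q m * qpochhammer_inf (a * q ^ m) q"
proof (rule LIMSEQ_unique)
  show "(\<lambda>n. qpochhammer a q (m + n)) \<longlonglongrightarrow> qpochhammer_inf a q"
    using LIMSEQ_ignore_initial_segment[OF qpochhammer_LIMSEQ[OF assms], of a m]
    by (simp add: add.commute)
  show "(\<lambda>n. qpochhammer a q (m + n)) \<longlonglongrightarrow>
      qpochhammer a q m * qpochhammer_inf (a * q ^ m) q"
    unfolding qpochhammer_add
    by (intro tendsto_mult tendsto_const qpochhammer_LIMSEQ assms)
qed

text \<open>The factors pair up as a difference of squares, (1 - a q^k)(1 + a q^k) = 1 - a^2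
  q^(2k).\<close>

lemma qpochhammer_mult_minus:
  "qpochhammer a q n * qpochhammer (- a) q n = qpochhammer (a\<^sup>2) (q\<^sup>2) n"
  by (induction n) (simp_all add: qpochhammer_Suc algebra_simps power2_eq_square power_mult_distrib)

lemma qpochhammer_inf_mult_minus:
  assumes "norm q < 1"
  shows "qpochhammer_inf a q * qpochhammer_inf (- a) q = qpochhammer_inf (a\<^sup>2) (q\<^sup>2)"
proof (rule LIMSEQ_unique)
  show "(\<lambda>n. qpochhammer a q n * qpochhammer (- a) q n) \<longlonglongrightarrow>
      qpochhammer_inf a q * qpochhammer_inf (- a) q"
    by (intro tendsto_mult qpochhammer_LIMSEQ assms)
  show "(\<lambda>n. qpochhammer a q n * qpochhammer (- a) q n) \<longlonglongrightarrow> qpochhammer_inf (a\<^sup>2) (q\<^sup>2)"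
    unfolding qpochhammer_mult_minus using assms
    by (intro qpochhammer_LIMSEQ) (simp add: norm_power power_less_one_iff)
qed

lemma qpochhammer_even_odd:
  "qpochhammer a q (2 * n) = qpochhammer a (q\<^sup>2) n * qpochhammer (a * q) (q\<^sup>2) n"
  by (induction n) (simp_all add: qpochhammer_Suc power_mult[symmetric] mult_ac)

lemma qpochhammer_inf_even_odd:
  assumes "norm q < 1"
  shows "qpochhammer_inf a q = qpochhammer_inf a (q\<^sup>2) * qpochhammer_inf (a * q) (q\<^sup>2)"
proof (rule LIMSEQ_unique)
  have q2: "norm (q\<^sup>2) < 1"
    using assms by (simp add: norm_power power_less_one_iff)
  show "(\<lambda>n. qpochhammer a q (2 * n)) \<longlonglongrightarrow> qpochhammer_inf a q"
    using qpochhammer_LIMSEQ[OF assms]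
    by (rule filterlim_compose) (rule mult_nat_left_at_top, simp)
  show "(\<lambda>n. qpochhammer a q (2 * n)) \<longlonglongrightarrow>
      qpochhammer_inf a (q\<^sup>2) * qpochhammer_inf (a * q) (q\<^sup>2)"
    unfolding qpochhammer_even_odd by (intro tendsto_mult qpochhammer_LIMSEQ q2)
qed

section \<open>The q-binomial theorem\<close>

text \<open>The quotient converges because its denominator has a nonzero limit. The case
  \<open>a = 0\<close> bounds 1/(q;q)_n uniformly, which later supplies majorants.\<close>

lemma qpochhammer_ratio_bounded:
  assumes "norm q < 1"
  obtains C where "C > 0" "\<And>n. norm (qpochhammer a q n / qpochhammer q q n) \<le> C"
proof -
  have "(\<lambda>n. qpochhammer a q n / qpochhammer q q n) \<longlonglongrightarrow>
      qpochhammer_inf a q / qpochhammer_inf q q"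
    using assms by (intro tendsto_divide qpochhammer_LIMSEQ qpochhammer_inf_nonzero)
  then have "Bseq (\<lambda>n. qpochhammer a q n / qpochhammer q q n)"
    by (intro convergent_imp_Bseq) (auto simp: convergent_def)
  then show thesis
    using that unfolding Bseq_def by blast
qed

text \<open>The series $F(z)$ satisfies $(1 - z) F(z) = (1 - a z) F(q z)$; iterating this
  equation moves the argument to $0$.\<close>

theorem q_binomial:
  fixes a q z :: complex
  assumes q: "norm q < 1" and z: "norm z < 1"
  shows "(\<lambda>n. qpochhammer a q n / qpochhammer q q n * z ^ n) sums
    (qpochhammer_inf (a * z) q / qpochhammer_inf z q)"
proof -
  define c where "c n = qpochhammer a q n / qpochhammer q q n" for n
  define F where "F w = (\<Sum>n. c n * w ^ n)" for w
  obtain C where C: "\<And>n. norm (c n) \<le> C"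
    using qpochhammer_ratio_bounded[OF q, of a] unfolding c_def by blast
  have summ: "summable (\<lambda>n. c n * w ^ n)" if "norm w < 1" for w
  proof (rule summable_comparison_test'[of "\<lambda>n. C * norm w ^ n" 0])
    show "summable (\<lambda>n. C * norm w ^ n)"
      using that by (intro summable_mult summable_geometric) simp
    show "norm (c n * w ^ n) \<le> C * norm w ^ n" for n
      using C by (simp add: norm_mult norm_power mult_right_mono)
  qed
  have c0: "c 0 = 1"
    by (simp add: c_def)
  have rec: "(1 - q ^ Suc n) * c (Suc n) = (1 - a * q ^ n) * c n" for n
    using qpochhammer_nonzero[OF q q] one_minus_mult_power_nonzero[OF q q, of n]
    by (simp add: c_def qpochhammer_Suc field_simps)
  have step: "(1 - w) * F w = (1 - a * w) * F (q * w)" if w: "norm w < 1" for w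
  proof -
    have qw: "norm (q * w) < 1"
      using q w mult_strict_mono[of "norm q" 1 "norm w" 1] by (simp add: norm_mult)
    have 1: "(\<lambda>n. c n * w ^ n) sums F w" "(\<lambda>n. c n * (q * w) ^ n) sums F (q * w)"
      using summ[OF w] summ[OF qw] by (auto simp: F_def summable_sums)
    have 2: "(\<lambda>n. c (Suc n) * w ^ Suc n) sums (F w - 1)"
      "(\<lambda>n. c (Suc n) * (q * w) ^ Suc n) sums (F (q * w) - 1)"
      using 1[THEN sums_split_initial_segment, of 1] by (simp_all add: c0)
    \<comment> \<open>Subtracting the series at \<open>q * w\<close> puts the factor
      \<open>1 - q ^ Suc n\<close> on each coefficient, which is what \<open>rec\<close> needs to
      lower the index.\<close>
    have "(\<lambda>n. c (Suc n) * w ^ Suc n - c (Suc n) * (q * w) ^ Suc n)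
      sums ((F w - 1) - (F (q * w) - 1))"
      by (intro sums_diff 2)
    moreover have "c (Suc n) * w ^ Suc n - c (Suc n) * (q * w) ^ Suc n
      = w * (c n * w ^ n) - a * w * (c n * (q * w) ^ n)" for n
    proof -
      have "c (Suc n) * w ^ Suc n - c (Suc n) * (q * w) ^ Suc n
        = (1 - q ^ Suc n) * c (Suc n) * w ^ Suc n"
        unfolding power_mult_distrib by (simp add: algebra_simps)
      also have "\<dots> = w * (c n * w ^ n) - a * w * (c n * (q * w) ^ n)"
        unfolding rec power_mult_distrib by (simp add: algebra_simps)
      finally show ?thesis .
    qed
    moreover have "(\<lambda>n. w * (c n * w ^ n) - a * w * (c n * (q * w) ^ n))
      sums (w * F w - a * w * F (q * w))"
      by (intro sums_diff sums_mult 1)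
    ultimately have "F w - F (q * w) = w * F w - a * w * F (q * w)"
      using sums_unique2 by fastforce
    then show ?thesis
      by (simp add: algebra_simps)
  qed
  have iter: "qpochhammer z q n * F z = qpochhammer (a * z) q n * F (q ^ n * z)" for n
  proof (induction n)
    case (Suc n)
    have "norm (q ^ n * z) < 1"
      using q z by (auto simp: norm_mult norm_power mult.commute
          intro: order.strict_trans1[OF mult_left_le[OF power_le_one]])
    from step[OF this] Suc.IH show ?case
      by (simp add: qpochhammer_Suc mult_ac) (metis mult.assoc mult.commute mult.left_commute)
  qed simp
  \<comment> \<open>The point \<open>1/2\<close> only witnesses a positive radius of
    convergence.\<close>
  have "isCont F 0"
    unfolding F_def using summ[of "1/2"] by (intro isCont_powser) auto
  moreover have "(\<lambda>n. q ^ n * z) \<longlonglongrightarrow> 0"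
    using q by (intro tendsto_mult_left_zero LIMSEQ_power_zero)
  ultimately have "(\<lambda>n. F (q ^ n * z)) \<longlonglongrightarrow> F 0"
    by (rule isCont_tendsto_compose)
  then have "(\<lambda>n. qpochhammer (a * z) q n * F (q ^ n * z)) \<longlonglongrightarrow> qpochhammer_inf (a * z) q * F 0"
    by (intro tendsto_mult qpochhammer_LIMSEQ q)
  moreover have "(\<lambda>n. qpochhammer z q n * F z) \<longlonglongrightarrow> qpochhammer_inf z q * F z"
    by (intro tendsto_mult qpochhammer_LIMSEQ q tendsto_const)
  moreover have "F 0 = 1"
    using powser_zero[of c] by (simp add: F_def c0)
  ultimately have "qpochhammer_inf z q * F z = qpochhammer_inf (a * z) q"
    unfolding iter using LIMSEQ_unique by fastforce
  then have "F z = qpochhammer_inf (a * z) q / qpochhammer_inf z q"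
    using qpochhammer_inf_nonzero[OF z q] by (simp add: field_simps)
  then show ?thesis
    using summable_sums[OF summ[OF z]] by (simp add: F_def c_def)
qed

section \<open>Gaussian binomial coefficients and the finite q-binomial theorem\<close>

text \<open>For \<open>k > n\<close> the value 0 has to be imposed: truncated subtraction would turn
  \<open>n - k\<close> into 0 and leave a quotient that is nonzero for |q| < 1.\<close>

definition qbinomial :: "complex \<Rightarrow> nat \<Rightarrow> nat \<Rightarrow> complex" where
  "qbinomial q n k = (if k \<le> n
     then qpochhammer q q n / (qpochhammer q q k * qpochhammer q q (n - k)) else 0)"

lemma qbinomial_0_right:
  assumes "norm q < 1"
  shows "qbinomial q n 0 = 1"
  using qpochhammer_nonzero[OF assms assms] by (simp add: qbinomial_def)

lemma qbinomial_symmetric: "k \<le> n \<Longrightarrow> qbinomial q n (n - k) = qbinomial q n k"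
  by (simp add: qbinomial_def mult.commute)

text \<open>This is the q-Pascal rule with weight q^(n-k), multiplied by q^k to avoid subtraction in
  the exponent. With n = k + d + 1 it comes from 1 - q^(n+1) = (1 - q^(d+1)) + q^(d+1) (1 -
  q^(k+1)).\<close>

lemma qbinomial_Suc_Suc:
  assumes q: "norm q < 1"
  shows "q ^ k * qbinomial q (Suc n) (Suc k) = q ^ k * qbinomial q n (Suc k) + q ^ n * qbinomial q n k"
proof -
  note nz = qpochhammer_nonzero[OF q q] one_minus_mult_power_nonzero[OF q q]
  consider "k < n" | "k = n" | "n < k"
    by linarith
  then show ?thesis
  proof cases
    case 1
    then obtain d where d: "n = Suc (k + d)"
      using less_iff_Suc_add by auto
    define A B C where "A = qpochhammer q q k" and "B = qpochhammer q q d"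
      and "C = qpochhammer q q n"
    define u v w where "u = 1 - q * q ^ k" and "v = 1 - q * q ^ d" and "w = 1 - q * q ^ n"
    have nz': "A \<noteq> 0" "B \<noteq> 0" "u \<noteq> 0" "v \<noteq> 0"
      unfolding A_def B_def u_def v_def using nz by auto
    have w: "w = v + (q * q ^ d) * u"
      by (simp add: w_def v_def u_def d power_add algebra_simps)
    have "qbinomial q (Suc n) (Suc k) = C * w / (A * u * (B * v))"
      "qbinomial q n (Suc k) = C / (A * u * B)"
      "qbinomial q n k = C / (A * (B * v))"
      by (simp_all add: qbinomial_def d A_def B_def C_def u_def v_def w_def qpochhammer_Suc Suc_diff_le)
    moreover have "q ^ n = q ^ k * (q * q ^ d)"
      by (simp add: d power_add)
    moreover have "C * (v + (q * q ^ d) * u) / (A * u * (B * v))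
      = C / (A * u * B) + q * q ^ d * (C / (A * (B * v)))"
      using nz' by (simp add: field_simps)
    ultimately show ?thesis
      by (simp add: w algebra_simps)
  next
    case 2
    then show ?thesis
      using nz by (simp add: qbinomial_def)
  next
    case 3
    then show ?thesis
      by (simp add: qbinomial_def)
  qed
qed

theorem qpochhammer_eq_sum_qbinomial:
  assumes q: "norm q < 1"
  shows "qpochhammer (- z) q n = (\<Sum>k\<le>n. qbinomial q n k * q ^ (k choose 2) * z ^ k)"
proof (induction n)
  case 0
  then show ?case
    by (simp add: qbinomial_0_right[OF q] binomial_eq_0)
next
  case (Suc n)
  define t where "t m k = qbinomial q m k * q ^ (k choose 2) * z ^ k" for m k
  have t0: "t m 0 = 1" for m
    by (simp add: t_def qbinomial_0_right[OF q] binomial_eq_0)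
  have tS: "t (Suc n) (Suc k) = t n (Suc k) + z * q ^ n * t n k" for k
  proof -
    \<comment> \<open>Since C(k+1,2) = k + C(k,2), the power of \<open>q\<close> in the term
      provides the factor \<open>q ^ k\<close> that the Pascal rule requires.\<close>
    have "t (Suc n) (Suc k) = (q ^ k * qbinomial q (Suc n) (Suc k)) * q ^ (k choose 2) * z ^ Suc k"
      by (simp add: t_def numeral_2_eq_2 power_add)
    also have "\<dots> = t n (Suc k) + z * q ^ n * t n k"
      unfolding qbinomial_Suc_Suc[OF q] by (simp add: t_def numeral_2_eq_2 power_add algebra_simps)
    finally show ?thesis .
  qed
  have "(\<Sum>k\<le>Suc n. t (Suc n) k) = t n 0 + (\<Sum>k\<le>n. t n (Suc k)) + z * q ^ n * (\<Sum>k\<le>n. t n k)"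
    by (simp add: sum.atMost_Suc_shift t0 tS sum.distrib sum_distrib_left del: sum.atMost_Suc)
  also have "t n 0 + (\<Sum>k\<le>n. t n (Suc k)) = (\<Sum>k\<le>Suc n. t n k)"
    by (simp add: sum.atMost_Suc_shift del: sum.atMost_Suc)
  \<comment> \<open>The added top term contains \<open>qbinomial q n (Suc n)\<close>, which is
    0.\<close>
  also have "\<dots> = (\<Sum>k\<le>n. t n k)"
    by (simp add: t_def qbinomial_def)
  also have "\<dots> + z * q ^ n * (\<Sum>k\<le>n. t n k) = qpochhammer (- z) q (Suc n)"
    using Suc.IH by (simp add: t_def qpochhammer_Suc algebra_simps)
  finally show ?case
    by (simp add: t_def)
qed

section \<open>The Jacobi triple product\<close>

text \<open>Exponent bookkeeping for the folded sum, here for the upper index k = n + 1 + m and in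
  the next lemma for the lower index k = n - m. The summand \<open>n * k\<close> accounts for the
  denominator (q^n)^k, so both halves receive the same power C(m+1,2) of q.\<close>

lemma triangle_exponent_shift:
  "((n + 1 + m) choose 2) + (Suc n choose 2) = (Suc m choose 2) + n * (n + 1 + m)"
  by (induction n) (simp_all add: numeral_2_eq_2 algebra_simps)

lemma triangle_exponent_shift':
  assumes "m \<le> n"
  shows "((n - m) choose 2) + (Suc n choose 2) = (Suc m choose 2) + n * (n - m)"
proof -
  obtain d where d: "n = d + m"
    using assms by (metis le_add_diff_inverse2)
  have "d + 2 * (d choose 2) = d * d"
    by (induction d) (simp_all add: numeral_2_eq_2 algebra_simps)
  then show ?thesis
    unfolding d by (induction m) (simp_all add: numeral_2_eq_2 algebra_simps)
qed

text \<open>Each factor satisfies (1 + z q^(k-n)) q^(n-k) = z (1 + q^(n-k)/z) for k < n, and the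
  powers q^(n-k) multiply to q^C(n+1,2).\<close>

lemma qpochhammer_reflect:
  assumes "q \<noteq> 0" "z \<noteq> 0"
  shows "qpochhammer (- (z / q ^ n)) q n * q ^ (Suc n choose 2) = z ^ n * qpochhammer (- (q / z)) q n"
proof (induction n)
  case (Suc n)
  have "qpochhammer (- (z / q ^ Suc n)) q (Suc n) =
      (1 + z / q ^ Suc n) * qpochhammer (- (z / q ^ n)) q n"
    using qpochhammer_add[of "- (z / q ^ Suc n)" q 1 n] assms
    by (simp add: qpochhammer_def)
  then have "qpochhammer (- (z / q ^ Suc n)) q (Suc n) * q ^ (Suc (Suc n) choose 2) =
      (1 + z / q ^ Suc n) * q ^ Suc n * (qpochhammer (- (z / q ^ n)) q n * q ^ (Suc n choose 2))"
    by (simp add: numeral_2_eq_2 power_add)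
  also have "\<dots> = (1 + z / q ^ Suc n) * q ^ Suc n * (z ^ n * qpochhammer (- (q / z)) q n)"
    by (simp only: Suc.IH)
  also have "\<dots> = z ^ Suc n * qpochhammer (- (q / z)) q (Suc n)"
    using assms by (simp add: qpochhammer_Suc field_simps)
  finally show ?case .
qed (simp add: numeral_2_eq_2)

text \<open>Folding at the centre, $k \mapsto 2n + 1 - k$, leaves a sum over natural numbers only.\<close>

lemma finite_jacobi_triple_product:
  assumes q: "norm q < 1" "q \<noteq> 0" and z: "z \<noteq> 0"
  shows "qpochhammer (- (q / z)) q n * qpochhammer (- z) q (Suc n) =
    (\<Sum>m\<le>n. qbinomial q (2 * n + 1) (n - m) * q ^ (Suc m choose 2) * (z ^ Suc m + 1 / z ^ m))"
proof -
  define Q where "Q = q ^ (Suc n choose 2)"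
  define t where "t k = qbinomial q (2 * n + 1) k * q ^ (k choose 2) * (z / q ^ n) ^ k" for k
  have qn: "q ^ n \<noteq> 0" and zn: "z ^ n \<noteq> 0"
    using q z by auto
  \<comment> \<open>Replacing \<open>z\<close> by \<open>z / q ^ n\<close> centres the product: the
    first \<open>n\<close> factors get reflected, the other \<open>n + 1\<close> form
    \<open>qpochhammer (- z) q (Suc n)\<close>.\<close>
  have "qpochhammer (- (z / q ^ n)) q (n + Suc n) = (\<Sum>k\<le>2 * n + 1. t k)"
    using qpochhammer_eq_sum_qbinomial[OF q(1), of "z / q ^ n" "2 * n + 1"]
    by (simp add: t_def mult_2)
  also have "\<dots> = (\<Sum>k\<le>n. t k) + (\<Sum>k\<in>{n+1..2 * n + 1}. t k)"
  proof -
    have "{..2 * n + 1} = {..n} \<union> {n + 1..2 * n + 1}"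
      by auto
    then show ?thesis
      by (simp only:) (rule sum.union_disjoint, auto)
  qed
  also have "(\<Sum>k\<le>n. t k) = (\<Sum>m\<le>n. t (n - m))"
    by (rule sum.reindex_bij_witness[of _ "\<lambda>m. n - m" "\<lambda>m. n - m"]) auto
  also have "(\<Sum>k\<in>{n+1..2 * n + 1}. t k) = (\<Sum>m\<le>n. t (n + 1 + m))"
    by (rule sum.reindex_bij_witness[of _ "\<lambda>m. n + 1 + m" "\<lambda>k. k - (n + 1)"]) auto
  finally have sum_eq: "qpochhammer (- (z / q ^ n)) q (n + Suc n) * Q
      = (\<Sum>m\<le>n. t (n - m) * Q + t (n + 1 + m) * Q)"
    by (simp add: sum.distrib sum_distrib_right distrib_right)
  have "qpochhammer (- (z / q ^ n)) q (n + Suc n) * Q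
      = (qpochhammer (- (z / q ^ n)) q n * Q) * qpochhammer (- z) q (Suc n)"
    unfolding qpochhammer_add using qn by (simp add: mult_ac)
  also have "\<dots> = z ^ n * (qpochhammer (- (q / z)) q n * qpochhammer (- z) q (Suc n))"
    unfolding Q_def qpochhammer_reflect[OF q(2) z] by simp
  finally have lhs: "z ^ n * (qpochhammer (- (q / z)) q n * qpochhammer (- z) q (Suc n))
      = (\<Sum>m\<le>n. t (n - m) * Q + t (n + 1 + m) * Q)"
    using sum_eq by simp
  \<comment> \<open>The exponent \<open>e\<close> is specified by an additive equation, so that both
    folding cases fit without subtraction.\<close>
  have tQ: "t k * Q = qbinomial q (2 * n + 1) k * q ^ e * z ^ k"
    if "(k choose 2) + (Suc n choose 2) = e + n * k" for k e
  proof -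
    have "t k * Q = qbinomial q (2 * n + 1) k * z ^ k * (q ^ ((k choose 2) + (Suc n choose 2)) / (q ^ n) ^ k)"
      by (simp add: t_def Q_def power_add power_divide)
    also have "q ^ ((k choose 2) + (Suc n choose 2)) / (q ^ n) ^ k = q ^ e"
      unfolding that using q(2) by (simp add: power_add power_mult)
    finally show ?thesis
      by simp
  qed
  have "t (n - m) * Q + t (n + 1 + m) * Q =
      z ^ n * (qbinomial q (2 * n + 1) (n - m) * q ^ (Suc m choose 2) * (z ^ Suc m + 1 / z ^ m))"
    if "m \<le> n" for m
  proof -
    have "2 * n + 1 - (n - m) = n + 1 + m"
      using that by simp
    then have sym: "qbinomial q (2 * n + 1) (n + 1 + m) = qbinomial q (2 * n + 1) (n - m)"
      using qbinomial_symmetric[of "n - m" "2 * n + 1" q] by simp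
    have "z ^ (n - m) = z ^ n / z ^ m"
      using z that by (simp add: power_diff)
    then show ?thesis
      unfolding tQ[OF triangle_exponent_shift] tQ[OF triangle_exponent_shift'[OF that]] sym
      by (simp add: power_add algebra_simps)
  qed
  then have "z ^ n * (qpochhammer (- (q / z)) q n * qpochhammer (- z) q (Suc n)) =
      z ^ n * (\<Sum>m\<le>n. qbinomial q (2 * n + 1) (n - m) * q ^ (Suc m choose 2) * (z ^ Suc m + 1 / z ^ m))"
    unfolding lhs sum_distrib_left by (intro sum.cong) auto
  then show ?thesis
    unfolding mult_cancel_left using zn by blast
qed

text \<open>The ratio of consecutive terms, \<open>r ^ Suc m * b\<close>, tends to 0 however large
  \<open>b\<close> is. Hence both |z| and 1/|z| can serve as \<open>b\<close>.\<close>

lemma summable_triangle_power: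
  fixes r b :: real
  assumes r: "0 \<le> r" "r < 1" and b: "b \<ge> 0"
  shows "summable (\<lambda>m. r ^ (Suc m choose 2) * b ^ m)"
proof -
  have "(\<lambda>m. r ^ Suc m * b) \<longlonglongrightarrow> 0"
    using r LIMSEQ_Suc[OF LIMSEQ_power_zero[of r]] by (intro tendsto_mult_left_zero) simp
  then have "eventually (\<lambda>m. r ^ Suc m * b < 1/2) sequentially"
    by (rule order_tendstoD) simp
  then obtain N where N: "\<And>m. m \<ge> N \<Longrightarrow> r ^ Suc m * b < 1/2"
    unfolding eventually_sequentially by blast
  show ?thesis
  proof (rule summable_ratio_test[of "1/2" N])
    fix m assume "N \<le> m"
    have "norm (r ^ (Suc (Suc m) choose 2) * b ^ Suc m)
        = (r ^ Suc m * b) * (r ^ (Suc m choose 2) * b ^ m)"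
      using r b by (simp add: numeral_2_eq_2 power_add abs_mult)
    also have "\<dots> \<le> 1/2 * (r ^ (Suc m choose 2) * b ^ m)"
      using N[OF \<open>N \<le> m\<close>] r b by (intro mult_right_mono) auto
    finally show "norm (r ^ (Suc (Suc m) choose 2) * b ^ Suc m)
        \<le> 1/2 * norm (r ^ (Suc m choose 2) * b ^ m)"
      using r b by simp
  qed simp
qed

text \<open>The bilateral series of q^(k(k-1)/2) z^k is folded by pairing k = m + 1 with k = -m,
  which carry the same power of q. The proof lets n tend to infinity in the finite identity, using
  Tannery's theorem.\<close>

theorem jacobi_triple_product:
  fixes q z :: complex
  assumes q: "norm q < 1" "q \<noteq> 0" and z: "z \<noteq> 0"
  shows "(\<lambda>m. q ^ (Suc m choose 2) * (z ^ Suc m + 1 / z ^ m)) sums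
    (qpochhammer_inf (- z) q * qpochhammer_inf (- (q / z)) q * qpochhammer_inf q q)"
proof -
  define L where "L = qpochhammer_inf q q"
  have L: "L \<noteq> 0"
    unfolding L_def by (rule qpochhammer_inf_nonzero[OF q(1) q(1)])
  define s where "s m = q ^ (Suc m choose 2) * (z ^ Suc m + 1 / z ^ m)" for m
  \<comment> \<open>Extending by 0 for \<open>m > n\<close> turns the finite sums into series over a
    fixed index set, as Tannery's theorem requires.\<close>
  define a where "a m n = (if m \<le> n then qbinomial q (2 * n + 1) (n - m) * s m else 0)" for m n
  define r b where "r = norm q" and "b = norm z"
  have P: "qpochhammer q q \<longlonglongrightarrow> L"
    unfolding L_def by (rule qpochhammer_LIMSEQ[OF q(1)])
  obtain C where C: "C > 0" "\<And>n. norm (1 / qpochhammer q q n) \<le> C"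
    using qpochhammer_ratio_bounded[OF q(1), of 0] by (auto simp: qpochhammer_def)
  obtain D where D: "D > 0" "\<And>n. norm (qpochhammer q q n) \<le> D"
    using convergent_imp_Bseq[of "qpochhammer q q"] P unfolding Bseq_def convergent_def by blast
  have qb_bound: "norm (qbinomial q n k) \<le> D * C * C" for n k
  proof (cases "k \<le> n")
    case True
    then have "qbinomial q n k =
        qpochhammer q q n * (1 / qpochhammer q q k) * (1 / qpochhammer q q (n - k))"
      by (simp add: qbinomial_def)
    then have "norm (qbinomial q n k) = norm (qpochhammer q q n)
        * norm (1 / qpochhammer q q k) * norm (1 / qpochhammer q q (n - k))"
      by (simp only: norm_mult)
    also have "\<dots> \<le> D * C * C"
      using C D by (intro mult_mono) auto
    finally show ?thesis .
  qed (use C D in \<open>simp add: qbinomial_def\<close>)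
  define M where "M m = D * C * C * (b * (r ^ (Suc m choose 2) * b ^ m)
      + r ^ (Suc m choose 2) * (1 / b) ^ m)" for m
  have "summable M"
    unfolding M_def r_def b_def using q
    by (intro summable_mult summable_add summable_triangle_power) auto
  have s_bound: "norm (s m) \<le> b * (r ^ (Suc m choose 2) * b ^ m) + r ^ (Suc m choose 2) * (1 / b) ^ m" for m
  proof -
    have "norm (s m) = r ^ (Suc m choose 2) * norm (z ^ Suc m + 1 / z ^ m)"
      by (simp add: s_def norm_mult norm_power r_def)
    also have "\<dots> \<le> r ^ (Suc m choose 2) * (b ^ Suc m + (1 / b) ^ m)"
      by (intro mult_left_mono order.trans[OF norm_triangle_ineq])
        (simp_all add: r_def b_def norm_mult norm_power norm_divide power_divide)
    finally show ?thesis
      by (simp add: algebra_simps)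
  qed
  have bound: "norm (a m n) \<le> M m" for m n
  proof (cases "m \<le> n")
    case True
    then show ?thesis
      unfolding a_def M_def using C D qb_bound s_bound
      by (auto simp: norm_mult intro!: mult_mono)
  next
    case False
    then show ?thesis
      using C D order.trans[OF norm_ge_zero s_bound[of m]] by (simp add: a_def M_def)
  qed
  have limit: "(\<lambda>n. a m n) \<longlonglongrightarrow> s m / L" for m
  proof -
    have f1: "filterlim (\<lambda>n. n - m) sequentially sequentially"
      by (rule filterlim_minus_const_nat_at_top)
    have f2: "filterlim (\<lambda>n. n + 1 + m) sequentially sequentially"
      using filterlim_add_const_nat_at_top[of "Suc m"] by simp
    have f3: "filterlim (\<lambda>n. 2 * n + 1) sequentially sequentially"
      by (intro filterlim_compose[OF filterlim_add_const_nat_at_top] mult_nat_left_at_top) simp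
    \<comment> \<open>All three indices tend to infinity, so the Gaussian coefficient tends to L /
      L^2 = 1 / L.\<close>
    have "(\<lambda>n. qpochhammer q q (2 * n + 1)
        / (qpochhammer q q (n - m) * qpochhammer q q (n + 1 + m)) * s m) \<longlonglongrightarrow> L / (L * L) * s m"
      using L by (intro tendsto_intros filterlim_compose[OF P] f1 f2 f3) auto
    moreover have "eventually (\<lambda>n. qpochhammer q q (2 * n + 1)
        / (qpochhammer q q (n - m) * qpochhammer q q (n + 1 + m)) * s m = a m n) sequentially"
      using eventually_ge_at_top[of m]
    proof eventually_elim
      case (elim n)
      then have "2 * n + 1 - (n - m) = n + 1 + m"
        by simp
      with elim show ?case
        by (simp add: a_def qbinomial_def)
    qed
    ultimately show ?thesis
      using L by (auto intro: Lim_transform_eventually)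
  qed
  have "eventually (\<lambda>(m, n). norm (a m n) \<le> M m) (sequentially \<times>\<^sub>F sequentially)"
    using bound by (intro always_eventually) auto
  from tannerys_theorem[OF limit this \<open>summable M\<close>]
  have tannery: "summable (\<lambda>m. norm (s m / L))"
    "(\<lambda>n. \<Sum>m. a m n) \<longlonglongrightarrow> (\<Sum>m. s m / L)"
    by simp_all
  have "(\<Sum>m. a m n) = qpochhammer (- (q / z)) q n * qpochhammer (- z) q (Suc n)" for n
  proof -
    have "(\<Sum>m. a m n) = (\<Sum>m\<le>n. a m n)"
      by (intro suminf_finite) (auto simp: a_def)
    then show ?thesis
      unfolding finite_jacobi_triple_product[OF q z] by (simp add: a_def s_def mult.assoc)
  qed
  moreover have "(\<lambda>n. qpochhammer (- (q / z)) q n * qpochhammer (- z) q (Suc n))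
      \<longlonglongrightarrow> qpochhammer_inf (- (q / z)) q * qpochhammer_inf (- z) q"
    by (intro tendsto_mult qpochhammer_LIMSEQ LIMSEQ_Suc q)
  ultimately have "(\<Sum>m. s m / L) = qpochhammer_inf (- (q / z)) q * qpochhammer_inf (- z) q"
    using tannery(2) by (simp add: LIMSEQ_unique)
  then have "(\<lambda>m. s m / L) sums (qpochhammer_inf (- (q / z)) q * qpochhammer_inf (- z) q)"
    using summable_sums[OF summable_norm_cancel[OF tannery(1)]] by simp
  from sums_mult[OF this, of L] show ?thesis
    using L by (simp add: s_def L_def mult_ac)
qed

section \<open>Parity parts of series and the odd part of the theta series\<close>

lemma sums_pairs:
  fixes f :: "nat \<Rightarrow> complex"
  assumes "f sums s"
  shows "(\<lambda>k. f (2 * k) + f (2 * k + 1)) sums s"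
proof -
  have "(\<Sum>n = k * 2..<k * 2 + 2. f n) = f (2 * k) + f (2 * k + 1)" for k
    by (simp add: numeral_2_eq_2 mult.commute)
  then show ?thesis
    using sums_group[OF assms, of 2] by simp
qed

text \<open>Half the sum, or half the difference, of the plain and the alternating series has zeros
  at all indices of one parity; grouping in pairs removes them.\<close>

lemma sums_even_odd_parts:
  fixes f :: "nat \<Rightarrow> complex"
  assumes a: "f sums a" and b: "(\<lambda>n. (- 1) ^ n * f n) sums b"
  shows "(\<lambda>k. f (2 * k)) sums ((a + b) / 2)" "(\<lambda>k. f (2 * k + 1)) sums ((a - b) / 2)"
  using sums_pairs[OF sums_divide[OF sums_add[OF a b], of 2]]
    sums_pairs[OF sums_divide[OF sums_diff[OF a b], of 2]] by simp_all

text \<open>At z = 1 in the triple product every bracket equals 2. The product side simplifies by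
  Euler's identity (-q;q)_inf (q;q^2)_inf = 1.\<close>

lemma gauss_triangular_numbers:
  fixes q :: complex
  assumes q: "norm q < 1" "q \<noteq> 0"
  shows "(\<lambda>k. q ^ (Suc k choose 2)) sums
    (qpochhammer_inf (q\<^sup>2) (q\<^sup>2) / qpochhammer_inf q (q\<^sup>2))"
proof -
  have q2: "norm (q\<^sup>2) < 1"
    using q by (simp add: norm_power power_less_one_iff)
  let ?P = "qpochhammer_inf (q\<^sup>2) (q\<^sup>2)" and ?R = "qpochhammer_inf q (q\<^sup>2)"
  have nz: "?P \<noteq> 0" "?R \<noteq> 0"
    using q q2 by (simp_all add: qpochhammer_inf_nonzero)
  have 1: "qpochhammer_inf q q * qpochhammer_inf (- q) q = ?P"
    by (rule qpochhammer_inf_mult_minus[OF q(1)])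
  have 2: "qpochhammer_inf q q = ?R * ?P"
    using qpochhammer_inf_even_odd[OF q(1), of q] by (simp add: power2_eq_square)
  have 3: "qpochhammer_inf (- 1) q = 2 * qpochhammer_inf (- q) q"
    using qpochhammer_inf_split[OF q(1), of "- 1" 1] by (simp add: qpochhammer_def)
  have "?R * qpochhammer_inf (- q) q = 1"
    using 1 nz unfolding 2 by simp
  then have 4: "qpochhammer_inf (- q) q = 1 / ?R"
    using nz by (simp add: field_simps)
  have "(\<lambda>m. q ^ (Suc m choose 2) * 2) sums (2 * (?P / ?R))"
    using jacobi_triple_product[OF q, of 1] nz by (simp add: 3 4 2)
  from sums_divide[OF this, of 2] show ?thesis
    by simp
qed

text \<open>With q = x^2 and z = x or z = -x, the bilateral term q^(k(k-1)/2) z^k is x^(k^2) or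
  (-1)^k x^(k^2), so the difference keeps odd k only, doubled.\<close>

lemma theta_odd_part:
  fixes x :: complex
  assumes x: "norm x < 1" "x \<noteq> 0"
  shows "qpochhammer_inf (x\<^sup>2) (x\<^sup>2) *
      ((qpochhammer_inf (- x) (x\<^sup>2))\<^sup>2 - (qpochhammer_inf x (x\<^sup>2))\<^sup>2) =
    4 * x * (qpochhammer_inf (x ^ 16) (x ^ 16) / qpochhammer_inf (x ^ 8) (x ^ 16))"
proof -
  define q where "q = x\<^sup>2"
  have q: "norm q < 1" "q \<noteq> 0" "norm (q ^ 4) < 1" "q ^ 4 \<noteq> 0"
    using x by (simp_all add: q_def norm_power power_less_one_iff)
  define f where "f m = q ^ (Suc m choose 2) * (x ^ Suc m + 1 / x ^ m)
    - q ^ (Suc m choose 2) * ((- x) ^ Suc m + 1 / (- x) ^ m)" for m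
  have "q / x = x"
    using x by (simp add: q_def power2_eq_square)
  then have f: "f sums (qpochhammer_inf q q * ((qpochhammer_inf (- x) q)\<^sup>2 - (qpochhammer_inf x q)\<^sup>2))"
    unfolding f_def
    using sums_diff[OF jacobi_triple_product[OF q(1,2), of x] jacobi_triple_product[OF q(1,2), of "- x"]] x
    by (simp add: power2_eq_square algebra_simps)
  \<comment> \<open>Index 2k contributes the odd integer 2k + 1, and index 2k + 1 contributes its
    negative; both squares are 8 C(k+1,2) + 1.\<close>
  have pair: "f (2 * k) + f (Suc (2 * k)) = 4 * x * (q ^ 4) ^ (Suc k choose 2)" for k
  proof -
    have triangle: "2 * (Suc n choose 2) = n * Suc n" for n
      by (induction n) (simp_all add: numeral_2_eq_2)
    have e: "4 * (Suc k choose 2) = (Suc (2 * k) choose 2) + k"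
      using triangle[of k] triangle[of "2 * k"] by (simp add: algebra_simps)
    have e': "Suc (Suc (2 * k)) choose 2 = 4 * (Suc k choose 2) + k + 1"
      using triangle[of k] triangle[of "Suc (2 * k)"] by (simp add: algebra_simps)
    have xk: "x ^ (2 * k) = q ^ k" "x ^ (k * 2) = q ^ k"
      by (simp_all add: q_def power_mult[symmetric] mult.commute)
    have "f (2 * k) = 2 * x * (q ^ (Suc (2 * k) choose 2) * q ^ k)"
      by (simp add: f_def xk algebra_simps)
    also have "\<dots> = 2 * x * (q ^ 4) ^ (Suc k choose 2)"
      by (simp add: e power_add power_mult[symmetric])
    finally have 1: "f (2 * k) = 2 * x * (q ^ 4) ^ (Suc k choose 2)" .
    have "f (Suc (2 * k)) = 2 * (q ^ (Suc (Suc (2 * k)) choose 2) / (x * q ^ k))"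
      by (simp add: f_def xk algebra_simps)
    also have "\<dots> = 2 * ((q ^ 4) ^ (Suc k choose 2) * (q / x))"
      unfolding e' using q x by (simp add: power_add power_mult[symmetric])
    finally show ?thesis
      unfolding 1 \<open>q / x = x\<close> by simp
  qed
  have "(\<lambda>k. 4 * x * (q ^ 4) ^ (Suc k choose 2)) sums
      (qpochhammer_inf q q * ((qpochhammer_inf (- x) q)\<^sup>2 - (qpochhammer_inf x q)\<^sup>2))"
    using sums_pairs[OF f] pair by simp
  from sums_unique2[OF this sums_mult[OF gauss_triangular_numbers[OF q(3,4)]]]
  show ?thesis
    by (simp add: q_def power_mult[symmetric])
qed

section \<open>The double series: absolute convergence, the inner and outer sums, and their
  evaluation\<close>

text \<open>Absolute convergence justifies iterated summation; the majorant is a product of two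
  geometric series. The pair is ordered \<open>(j, i)\<close> because \<open>i\<close> is summed
  first.\<close>

lemma summable_on_double_series:
  fixes q :: complex
  assumes q: "norm q < 1"
  shows "(\<lambda>(j, i). q ^ (4 * i * j + i + 3 * j) /
      (qpochhammer q q (2 * i + 1) * qpochhammer q q (2 * j))) summable_on (UNIV \<times> UNIV)"
proof -
  define r where "r = norm q"
  have r: "0 \<le> r" "r < 1"
    using q by (simp_all add: r_def)
  obtain C where C: "C > 0" "\<And>n. norm (1 / qpochhammer q q n) \<le> C"
    using qpochhammer_ratio_bounded[OF q, of 0] by (auto simp: qpochhammer_def)
  have geom: "((\<lambda>i. r ^ i) has_sum (1 / (1 - r))) UNIV"
    using r by (intro norm_summable_imp_has_sum geometric_sums) (simp_all add: norm_power)
  have "(\<lambda>(j, i). C * C * (r ^ j * r ^ i)) summable_on (UNIV \<times> UNIV)"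
  proof (rule summable_on_SigmaI)
    fix j
    show "((\<lambda>i. case (j, i) of (j, i) \<Rightarrow> C * C * (r ^ j * r ^ i)) has_sum
        (C * C * (r ^ j * (1 / (1 - r))))) UNIV"
      unfolding prod.case by (intro has_sum_cmult_right geom)
  next
    show "(\<lambda>j. C * C * (r ^ j * (1 / (1 - r)))) summable_on UNIV"
      by (intro summable_on_cmult_right summable_on_cmult_left has_sum_imp_summable[OF geom])
  qed (use C r in auto)
  then show ?thesis
  proof (rule abs_summable_summable[OF Infinite_Sum.abs_summable_on_comparison_test'], clarify)
    fix j i :: nat
    have "norm (q ^ (4 * i * j + i + 3 * j) /
        (qpochhammer q q (2 * i + 1) * qpochhammer q q (2 * j))) =
      norm (1 / qpochhammer q q (2 * i + 1)) * norm (1 / qpochhammer q q (2 * j)) *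
        r ^ (4 * i * j + i + 3 * j)"
      by (simp add: norm_divide norm_mult norm_power r_def)
    also have "\<dots> \<le> C * C * r ^ (j + i)"
      using C r by (intro mult_mono power_decreasing) auto
    finally show "norm (q ^ (4 * i * j + i + 3 * j) /
        (qpochhammer q q (2 * i + 1) * qpochhammer q q (2 * j))) \<le> C * C * (r ^ j * r ^ i)"
      by (simp add: power_add)
  qed
qed

lemma sum_over_i:
  fixes q x :: complex
  assumes q: "norm q < 1" and x: "x\<^sup>2 = q" "x \<noteq> 0"
  shows "(\<lambda>i. q ^ (4 * i * j + i + 3 * j) / (qpochhammer q q (2 * i + 1) * qpochhammer q q (2 * j)))
    sums (q ^ j / qpochhammer q q (2 * j) / (2 * x) *
      (qpochhammer x q (2 * j) / qpochhammer_inf x q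
        - qpochhammer (- x) q (2 * j) / qpochhammer_inf (- x) q))"
proof -
  have x1: "norm x < 1"
    using q by (simp add: x(1)[symmetric] norm_power power_less_one_iff)
  define y where "y = x * q ^ (2 * j)"
  have "norm y \<le> norm x"
    using q unfolding y_def norm_mult norm_power by (intro mult_left_le power_le_one) auto
  with x1 have y: "norm y < 1" "norm (- y) < 1"
    by auto
  define f where "f n = y ^ n / qpochhammer q q n" for n
  \<comment> \<open>Euler's series is the case \<open>a = 0\<close> of the q-binomial
    theorem.\<close>
  have euler: "(\<lambda>n. w ^ n / qpochhammer q q n) sums (1 / qpochhammer_inf w q)"
    if "norm w < 1" for w
    using q_binomial[OF q that, of 0]
    by (simp add: qpochhammer_def qpochhammer_inf_def)
  have tail: "1 / qpochhammer_inf (w * q ^ (2 * j)) q = qpochhammer w q (2 * j) / qpochhammer_inf w q"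
    if "norm w < 1" for w
    unfolding qpochhammer_inf_split[OF q, of w "2 * j"]
    using qpochhammer_nonzero[OF that q] by simp
  have "f sums (qpochhammer x q (2 * j) / qpochhammer_inf x q)"
    using euler[OF y(1)] tail[OF x1] by (simp add: f_def[abs_def] y_def)
  moreover have "(\<lambda>n. (- 1) ^ n * f n) sums (qpochhammer (- x) q (2 * j) / qpochhammer_inf (- x) q)"
    using euler[OF y(2)] tail[of "- x"] x1 by (simp add: f_def y_def power_minus[of "_ * _"])
  ultimately have "(\<lambda>i. f (2 * i + 1)) sums
      ((qpochhammer x q (2 * j) / qpochhammer_inf x q
        - qpochhammer (- x) q (2 * j) / qpochhammer_inf (- x) q) / 2)"
    by (rule sums_even_odd_parts)
  \<comment> \<open>Because y^(2i+1) = x q^(4ij+i+2j), the factor q^j / x produces exactly the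
    required exponent.\<close>
  from sums_mult[OF this, of "q ^ j / qpochhammer q q (2 * j) / x"]
  have "(\<lambda>i. q ^ j / qpochhammer q q (2 * j) / x * f (2 * i + 1)) sums
      (q ^ j / qpochhammer q q (2 * j) / (2 * x) *
        (qpochhammer x q (2 * j) / qpochhammer_inf x q
        - qpochhammer (- x) q (2 * j) / qpochhammer_inf (- x) q))"
    by (simp add: mult_ac)
  moreover have "q ^ j / qpochhammer q q (2 * j) / x * f (2 * i + 1) =
      q ^ (4 * i * j + i + 3 * j) / (qpochhammer q q (2 * i + 1) * qpochhammer q q (2 * j))" for i
  proof -
    have "x ^ (2 * i) = q ^ i"
      by (simp add: x(1)[symmetric] power_mult)
    then have "x ^ (2 * i + 1) = x * q ^ i"
      by simp
    moreover define M where "M = q ^ (2 * j * (2 * i + 1))"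
    moreover have "y ^ (2 * i + 1) = x ^ (2 * i + 1) * M"
      by (simp only: y_def M_def power_mult_distrib power_mult)
    ultimately have "q ^ j / x * y ^ (2 * i + 1) = q ^ j * (q ^ i * M)"
      using x(2) by simp
    also have "\<dots> = q ^ (j + (i + 2 * j * (2 * i + 1)))"
      by (simp only: M_def power_add)
    also have "j + (i + 2 * j * (2 * i + 1)) = 4 * i * j + i + 3 * j"
      by (simp add: algebra_simps)
    finally have "q ^ j / x * y ^ (2 * i + 1) = q ^ (4 * i * j + i + 3 * j)" .
    moreover have "q ^ j / qpochhammer q q (2 * j) / x * f (2 * i + 1) =
        (q ^ j / x * y ^ (2 * i + 1)) / (qpochhammer q q (2 * i + 1) * qpochhammer q q (2 * j))"
      unfolding f_def by (simp only: times_divide_times_eq divide_divide_eq_left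
          times_divide_eq_left times_divide_eq_right mult_ac)
    ultimately show ?thesis
      by simp
  qed
  ultimately show ?thesis
    by simp
qed

text \<open>Parameter and argument are \<open>x\<close> and \<open>x\<close>, or \<open>x\<close>
  and \<open>- x\<close>, so their products are \<open>q\<close> and \<open>- q\<close>. Only
  \<open>x\<^sup>2 = q\<close> is assumed of \<open>x\<close>, which lets the result apply to
  \<open>- x\<close> as well.\<close>

lemma sum_over_j:
  fixes q x :: complex
  assumes q: "norm q < 1" and x: "x\<^sup>2 = q"
  shows "(\<lambda>j. q ^ j / qpochhammer q q (2 * j) * qpochhammer x q (2 * j)) sums
    ((qpochhammer_inf q q / qpochhammer_inf x q
      + qpochhammer_inf (- q) q / qpochhammer_inf (- x) q) / 2)"
proof -
  have x1: "norm x < 1"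
    using q by (simp add: x[symmetric] norm_power power_less_one_iff)
  have xx: "x * x = q"
    using x by (simp add: power2_eq_square)
  define f where "f n = qpochhammer x q n / qpochhammer q q n * x ^ n" for n
  have "f sums (qpochhammer_inf q q / qpochhammer_inf x q)"
    using q_binomial[OF q x1, of x] by (simp add: f_def[abs_def] xx)
  moreover have "(\<lambda>n. (- 1) ^ n * f n) sums (qpochhammer_inf (- q) q / qpochhammer_inf (- x) q)"
    using q_binomial[OF q, of "- x" x] x1 by (simp add: f_def xx power_minus[of x] mult_ac)
  ultimately have "(\<lambda>j. f (2 * j)) sums ((qpochhammer_inf q q / qpochhammer_inf x q
      + qpochhammer_inf (- q) q / qpochhammer_inf (- x) q) / 2)"
    by (rule sums_even_odd_parts)
  moreover have "f (2 * j) = q ^ j / qpochhammer q q (2 * j) * qpochhammer x q (2 * j)" for j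
    by (simp add: f_def power_mult x mult.commute[of "q ^ j"])
  ultimately show ?thesis
    by simp
qed

theorem theorem1p2:
  fixes q :: complex
  assumes "norm q < 1"
  shows "((\<lambda>(i, j). q ^ (4 * i * j + i + 3 * j) /
             (qpochhammer q q (2 * i + 1) * qpochhammer q q (2 * j)))
          has_sum
            (qpochhammer_inf (q ^ 8) (q ^ 8) /
             ((qpochhammer_inf q (q ^ 2))\<^sup>2 * qpochhammer_inf (q ^ 4) (q ^ 8))))
         (UNIV :: (nat \<times> nat) set)"
proof (cases "q = 0")
  case True
  \<comment> \<open>The case \<open>q = 0\<close> is separate since later steps divide by
    \<open>x\<close>. Only the term at (0,0) survives, and both sides are 1.\<close>
  have "((\<lambda>(i, j). q ^ (4 * i * j + i + 3 * j) /
      (qpochhammer q q (2 * i + 1) * qpochhammer q q (2 * j))) has_sum 1) {(0, 0) :: nat \<times> nat}"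
    using has_sum_finite[of "{(0, 0) :: nat \<times> nat}" "\<lambda>(i, j). q ^ (4 * i * j + i + 3 * j) /
      (qpochhammer q q (2 * i + 1) * qpochhammer q q (2 * j))"] by (simp add: True qpochhammer_def)
  then have "((\<lambda>(i, j). q ^ (4 * i * j + i + 3 * j) /
      (qpochhammer q q (2 * i + 1) * qpochhammer q q (2 * j))) has_sum 1) (UNIV :: (nat \<times> nat) set)"
    by (subst has_sum_cong_neutral[where T = "{(0, 0)}"]) (auto simp: True power_0_left split: if_splits)
  then show ?thesis
    by (simp add: True qpochhammer_inf_def)
next
  case False
  define x where "x = csqrt q"
  have x: "x\<^sup>2 = q" "x \<noteq> 0" "(- x)\<^sup>2 = q"
    using False by (simp_all add: x_def)
  have x1: "norm x < 1"
    using assms by (simp add: x(1)[symmetric] norm_power power_less_one_iff)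
  define u v p w where "u = qpochhammer_inf x q" and "v = qpochhammer_inf (- x) q"
    and "p = qpochhammer_inf q q" and "w = qpochhammer_inf (- q) q"
  have nz: "u \<noteq> 0" "v \<noteq> 0"
    using x1 assms by (simp_all add: u_def v_def qpochhammer_inf_nonzero)
  define T where "T = qpochhammer_inf (q ^ 8) (q ^ 8) / qpochhammer_inf (q ^ 4) (q ^ 8)"
  define f where "f = (\<lambda>(j, i). q ^ (4 * i * j + i + 3 * j) /
      (qpochhammer q q (2 * i + 1) * qpochhammer q q (2 * j)))"
  define g where "g j = q ^ j / qpochhammer q q (2 * j) / (2 * x) *
      (qpochhammer x q (2 * j) / u - qpochhammer (- x) q (2 * j) / v)" for j
  have summ: "f summable_on (UNIV \<times> UNIV)"
    unfolding f_def by (rule summable_on_double_series[OF assms])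
  have inner: "((\<lambda>i. f (j, i)) has_sum g j) UNIV" for j
  proof -
    have "(\<lambda>i. f (j, i)) summable_on UNIV"
      using summable_on_SigmaD1[of "\<lambda>j i. f (j, i)" UNIV "\<lambda>_. UNIV" j] summ by simp
    moreover have "(\<lambda>i. f (j, i)) sums g j"
      using sum_over_i[OF assms x(1,2), of j] by (simp add: f_def g_def u_def v_def)
    ultimately show ?thesis
      by (metis has_sum_imp_sums has_sum_infsum sums_unique2)
  qed
  have "(\<lambda>j. (q ^ j / qpochhammer q q (2 * j) * qpochhammer x q (2 * j)) * (1 / (2 * x * u))
      - (q ^ j / qpochhammer q q (2 * j) * qpochhammer (- x) q (2 * j)) * (1 / (2 * x * v))) sums
      ((p / u + w / v) / 2 * (1 / (2 * x * u)) - (p / v + w / u) / 2 * (1 / (2 * x * v)))"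
    using sum_over_j[OF assms x(1)] sum_over_j[OF assms x(3)]
    by (intro sums_diff sums_mult2) (simp_all add: u_def v_def p_def w_def)
  then have "g sums ((p / u + w / v) / 2 * (1 / (2 * x * u)) - (p / v + w / u) / 2 * (1 / (2 * x * v)))"
    by (simp add: g_def[abs_def] algebra_simps)
  also have "(p / u + w / v) / 2 * (1 / (2 * x * u)) - (p / v + w / u) / 2 * (1 / (2 * x * v))
      = p * (v\<^sup>2 - u\<^sup>2) / (4 * x * (u * v)\<^sup>2)"
    using nz x(2) by (simp add: field_simps power2_eq_square)
  \<comment> \<open>In terms of \<open>x\<close>, x^16 = q^8 and x^8 = q^4.\<close>
  also have "p * (v\<^sup>2 - u\<^sup>2) = 4 * x * T"
    using theta_odd_part[OF x1 x(2)] power_mult[of x 2 8] power_mult[of x 2 4]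
    by (simp add: p_def u_def v_def T_def x(1))
  also have "u * v = qpochhammer_inf q (q ^ 2)"
    using qpochhammer_inf_mult_minus[OF assms, of x] by (simp add: u_def v_def x(1))
  finally have "g sums (T / (qpochhammer_inf q (q ^ 2))\<^sup>2)"
    using x(2) by simp
  moreover have "(f has_sum infsum f (UNIV \<times> UNIV)) (UNIV \<times> UNIV)"
    using summ by simp
  \<comment> \<open>Summing over \<open>i\<close> first shows that the total of \<open>f\<close> is
    also the sum of \<open>g\<close>, whose value is already known.\<close>
  moreover from this have "(g has_sum infsum f (UNIV \<times> UNIV)) UNIV"
    by (rule has_sum_SigmaD) (use inner in auto)
  ultimately have "(f has_sum (T / (qpochhammer_inf q (q ^ 2))\<^sup>2)) (UNIV \<times> UNIV)"
    by (metis has_sum_imp_sums sums_unique2)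
  \<comment> \<open>The swap restores the index order \<open>(i, j)\<close> of the theorem.\<close>
  then have "((\<lambda>ij. f (prod.swap ij)) has_sum (T / (qpochhammer_inf q (q ^ 2))\<^sup>2)) UNIV"
    by (subst has_sum_reindex_bij_betw[of prod.swap UNIV UNIV]) (simp_all add: bij_swap)
  then show ?thesis
    by (simp add: f_def T_def case_prod_unfold mult_ac)
qed

end
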